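(* Let $n$ be a positive integer and let $a_1, \dots, a_n$ be nonzero integers. Suppose there is a prime $p$ such that, for all $1 \le i, j \le n$, $O_p(a_i) \equiv O_p(a_j) \pmod n$ implies $i = j$. Then the equation $a_1 x_1 + \cdots + a_n x_n = 0$ is not $n$-regular.
   Context: $\mathbb{N}$ denotes the set of positive integers. For a positive integer $r$, an $r$-coloring of the positive integers is any function $C : \mathbb{N} \to \{1, \dots, r\}$. A linear homogeneous equation in $n$ variables is an equation $a_1 x_1 + \cdots + a_n x_n = 0$ with all $a_i \in \mathbb{Z} \setminus \{0\}$. It is called $r$-regular if for every $r$-coloring $C$ of the positive integers there is a monochromatic solution, i.e. positive integers $x_1, \dots, x_n$ (not necessarily distinct) satisfying the equation with $C(x_1) = \cdots = C(x_n)$. For a prime $p$ and a nonzero integer $x$, $O_p(x)$ denotes the $p$-adic order of $x$, i.e. the largest integer $v \ge 0$ such that $p^v \mid x$. *)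

theory Defs
  imports "HOL-Library.FuncSet" "HOL-Number_Theory.Number_Theory"
begin

text \<open>
  The positive integers are the set \<open>{1..}\<close> of type \<^typ>\<open>nat set\<close>; the value of a
  coloring at \<open>0\<close> is unconstrained and irrelevant. The equation
  \<open>a\<^sub>1 x\<^sub>1 + \<dots> + a\<^sub>n x\<^sub>n = 0\<close> is given by \<open>n\<close> and a
  coefficient function \<open>a\<close>, of which only the values on \<open>{1..n}\<close> matter.
\<close>

definition coloring :: "nat \<Rightarrow> (nat \<Rightarrow> nat) \<Rightarrow> bool" where
  "coloring r C \<longleftrightarrow> C \<in> {1..} \<rightarrow> {1..r}"

definition solution :: "nat \<Rightarrow> (nat \<Rightarrow> int) \<Rightarrow> (nat \<Rightarrow> nat) \<Rightarrow> bool" where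
  "solution n a x \<longleftrightarrow> x \<in> {1..n} \<rightarrow> {1..} \<and> (\<Sum>i=1..n. a i * int (x i)) = 0"

definition monochromatic :: "nat \<Rightarrow> (nat \<Rightarrow> nat) \<Rightarrow> (nat \<Rightarrow> nat) \<Rightarrow> bool" where
  "monochromatic n C x \<longleftrightarrow> (\<forall>i\<in>{1..n}. \<forall>j\<in>{1..n}. C (x i) = C (x j))"

definition regular :: "nat \<Rightarrow> nat \<Rightarrow> (nat \<Rightarrow> int) \<Rightarrow> bool" where
  "regular r n a \<longleftrightarrow>
     (\<forall>C. coloring r C \<longrightarrow> (\<exists>x. solution n a x \<and> monochromatic n C x))"

end

theory Submission
  imports Defs
begin

text \<open>
  Colour \<open>x\<close> by the residue of \<open>O\<^sub>p(x)\<close> modulo \<open>n\<close>. In a monochromatic solution the terms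
  \<open>a\<^sub>i x\<^sub>i\<close> then have \<open>p\<close>-adic orders that are pairwise incongruent modulo \<open>n\<close>, hence distinct, so
  the term of least order cannot be cancelled by the others.
\<close>

text \<open>By injectivity, the least multiplicity \<open>m\<close> is attained by only one term.
  All other terms are divisible by \<open>p ^ Suc m\<close>; if the sum vanished, that term would be
  too.\<close>

lemma sum_nonzero_if_inj_on_multiplicity:
  fixes f :: "'a \<Rightarrow> 'b::{factorial_semiring, comm_ring_1}"
  assumes fin: "finite S" and ne: "S \<noteq> {}"
    and p: "prime p"
    and nz: "\<And>i. i \<in> S \<Longrightarrow> f i \<noteq> 0"
    and inj: "inj_on (\<lambda>i. multiplicity p (f i)) S"
  shows "sum f S \<noteq> 0"
proof
  assume zero: "sum f S = 0"
  have np: "\<not> is_unit p" using p by (simp add: prime_elem_not_unit)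
  define v where "v = (\<lambda>i. multiplicity p (f i))"
  obtain i where i: "i \<in> S" and least: "\<And>j. j \<in> S \<Longrightarrow> v i \<le> v j"
    using fin ne by (metis arg_min_if_finite(1,2) not_le)
  have "p ^ Suc (v i) dvd f j" if "j \<in> S - {i}" for j
  proof -
    have "v i \<noteq> v j" using inj i that by (auto simp: v_def inj_on_def)
    with least[of j] that have "Suc (v i) \<le> v j" by simp
    then show ?thesis by (metis multiplicity_dvd' v_def)
  qed
  then have "p ^ Suc (v i) dvd sum f (S - {i})" by (rule dvd_sum)
  moreover have "f i = - sum f (S - {i})"
    using zero sum.remove[OF fin i, of f] by (simp add: eq_neg_iff_add_eq_0)
  ultimately have "p ^ Suc (v i) dvd f i" by simp
  \<comment> \<open>\<open>multiplicity\<close> defaults to 0 for a zero argument or a unit base;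
    \<open>nz\<close> and \<open>np\<close> exclude both, so divisibility by a power does bound it
    below.\<close>
  with nz[OF i] np have "Suc (v i) \<le> v i"
    unfolding v_def by (intro multiplicity_geI) auto
  then show False by simp
qed

theorem theorem3p1:
  fixes n :: nat and a :: "nat \<Rightarrow> int"
  assumes "n > 0"
    and "\<And>i. i \<in> {1..n} \<Longrightarrow> a i \<noteq> 0"
    and "\<exists>p::nat. prime p \<and>
          (\<forall>i\<in>{1..n}. \<forall>j\<in>{1..n}.
             [multiplicity (int p) (a i) = multiplicity (int p) (a j)] (mod n) \<longrightarrow> i = j)"
  shows "\<not> regular n n a"
proof
  assume reg: "regular n n a"
  obtain p :: nat where p: "prime p"
    and incong: "\<And>i j. \<lbrakk>i \<in> {1..n}; j \<in> {1..n};
      [multiplicity (int p) (a i) = multiplicity (int p) (a j)] (mod n)\<rbrakk> \<Longrightarrow> i = j"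
    using assms(3) by blast
  \<comment> \<open>\<open>Suc\<close> shifts the residues 0 to \<open>n - 1\<close> onto the
    colours 1 to \<open>n\<close>.\<close>
  define C where "C = (\<lambda>x. Suc (multiplicity (int p) (int x) mod n))"
  have "coloring n C"
    using \<open>n > 0\<close> by (auto simp: coloring_def C_def Suc_le_eq)
  with reg obtain x where sol: "solution n a x" and mono: "monochromatic n C x"
    unfolding regular_def by blast
  \<comment> \<open>Additivity of \<open>multiplicity\<close> over products, used for
    \<open>mult\<close>, needs nonzero factors.\<close>
  have x0: "x i \<noteq> 0" if "i \<in> {1..n}" for i
    using sol that by (force simp: solution_def)
  have mult: "multiplicity (int p) (a i * int (x i)) =
      multiplicity (int p) (a i) + multiplicity (int p) (int (x i))" if "i \<in> {1..n}" for i
    using p x0[OF that] assms(2)[OF that] by (intro prime_elem_multiplicity_mult_distrib) auto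
  have "inj_on (\<lambda>i. multiplicity (int p) (a i * int (x i))) {1..n}"
  proof (rule inj_onI)
    fix i j
    assume i: "i \<in> {1..n}" and j: "j \<in> {1..n}"
      and "multiplicity (int p) (a i * int (x i)) = multiplicity (int p) (a j * int (x j))"
    then have "[multiplicity (int p) (a i) + multiplicity (int p) (int (x i)) =
        multiplicity (int p) (a j) + multiplicity (int p) (int (x j))] (mod n)"
      by (simp add: mult)
    \<comment> \<open>Equal colours give congruent orders of \<open>x i\<close> and
      \<open>x j\<close>; cancelling these leaves a congruence between the orders of the
      coefficients.\<close>
    moreover have "[multiplicity (int p) (int (x i)) = multiplicity (int p) (int (x j))] (mod n)"
      using mono i j unfolding monochromatic_def C_def cong_def by blast
    ultimately have "[multiplicity (int p) (a i) = multiplicity (int p) (a j)] (mod n)"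
      by (metis cong_add_lcancel_nat cong_add_rcancel_nat cong_add cong_refl cong_sym cong_trans)
    with i j show "i = j" by (rule incong)
  qed
  then have "(\<Sum>i=1..n. a i * int (x i)) \<noteq> 0"
    using \<open>n > 0\<close> p x0 assms(2) by (intro sum_nonzero_if_inj_on_multiplicity) auto
  with sol show False by (simp add: solution_def)
qed

end
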